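(* Let $(\Omega,\mathcal{B},m)$ be a measure space with $m$ $\sigma$-finite. Suppose that the function $\phi$ in the Hölder score is continuous on $\mathbb{R}_+$. 1. Suppose that the differentiable Bregman score with the potential function $G(f)$ is equivalent with the Hölder score with $\gamma>0$ (and this $\phi$), on $\mathcal{F}=L_{1+\gamma}^+$. Then $G(f)$ is given as $G(f)=\langle f^{1+\gamma}\rangle^{\kappa/(1+\gamma)}$ up to a positive constant factor, where $\kappa\ge 1$. 2. Suppose that the differentiable and separable Bregman score with the potential function $G(f)$ is equivalent with the Hölder score with $\gamma>0$ (and this $\phi$), on $\mathcal{F}=L_{1+\gamma}^+$. Then $G(f)$ is given as $G(f)=\langle f^{1+\gamma}\rangle$ up to a positive constant factor.
   Context: Notation: $\mathbb{R}_+=[0,\infty)$; $\langle f\rangle=\int_\Omega f\,dm$; $L_0$ is the set of measurable functions $\Omega\to\mathbb{R}$; $L_0^+=\{f\in L_0:f\ge0,\ f\neq0\}$; $L_{1+\gamma}^+=\{f\in L_0^+:\langle f^{1+\gamma}\rangle<\infty\}$; for a set $\mathcal{F}\subset L_0^+$, $\mathcal{P}=\{p\in\mathcal{F}:\langle p\rangle=1\}$. Hölder score with $\gamma>0$: let $\phi:\mathbb{R}_+\to\mathbb{R}$ satisfy $\phi(z)\ge -z^{1+\gamma}$ for all $z\ge0$ and $\phi(1)=-1$. On $\mathcal{F}=L_{1+\gamma}^+$ the Hölder score is $S(f,g)=\phi\big(\langle fg^\gamma\rangle/\langle g^{1+\gamma}\rangle\big)\langle g^{1+\gamma}\rangle$,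 $f,g\in\mathcal{F}$. Bregman score: for a convex set $\mathcal{F}\subset L_0^+$, let $G:\mathcal{F}\to\mathbb{R}$ be a convex function that is strictly convex on $\mathcal{P}$, and suppose that for each $g\in\mathcal{F}$ there is a function $G_g^*:\Omega\to\mathbb{R}$ such that $G(f)\ge G(g)+\int_\Omega G_g^* f\,dm-\int_\Omega G_g^* g\,dm$ for all $f,g\in\mathcal{F}$, the integrals being finite. The Bregman score with potential function $G$ is $S(f,g)=-G(g)-\int_\Omega G_g^*f\,dm+\int_\Omega G_g^*g\,dm$, $f,g\in\mathcal{F}$. It is called separable if $G(f)=\langle J(f)\rangle$ for a strictly convex function $J:\mathbb{R}_+\to\mathbb{R}$. It is called differentiable if the limit $\lim_{\varepsilon\to0}\{G((1-\varepsilon)f+\varepsilon g)-G(f)\}/\varepsilon$ exists for any $f,g\in\mathcal{F}$ for which there is $\delta>0$ with $(1-\varepsilon)f+\varepsilon g\in\mathcal{F}$ for all $\varepsilon\in(-\delta,\delta)$. Equivalence: two scores $S(f,g)$ and $\widetilde S(f,g)$ on $\mathcal{F}$ (real-valued functions on $\mathcal{F}\times\mathcal{F}$) are equivalent if there exists a strictly increasing function $\xi:\mathbb{R}\to\mathbb{R}$ such that $\widetilde S(f,g)=\xi(S(f,g))$ holds for all $f,g\in\mathcal{F}$.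
   Formalization: The potential G is determined only up to a positive factor and an additive constant (proved zero in part 2 when m(Ω)=∞), since adding a constant to G preserves all hypotheses; part 2 also excludes a measure m consisting of a single atom, where f^k for any k>1 is a counterexample. *)

theory Defs
  imports "HOL-Analysis.Analysis"
begin

text \<open>
  Functions on \<open>\<Omega>\<close> are not quotiented by almost-everywhere equality. Hence \<open>f \<noteq> 0\<close>, and
  distinctness in strict convexity, are read modulo null sets of the measure.
\<close>

definition L0_plus :: "'a measure \<Rightarrow> ('a \<Rightarrow> real) set" where
  "L0_plus M = {f \<in> borel_measurable M. (\<forall>x\<in>space M. 0 \<le> f x) \<and> \<not> (AE x in M. f x = 0)}"

definition Lp_plus :: "'a measure \<Rightarrow> real \<Rightarrow> ('a \<Rightarrow> real) set" where
  "Lp_plus M p = {f \<in> L0_plus M. integrable M (\<lambda>x. f x powr p)}"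

text \<open>A Bochner integral equal to 1 forces integrability, as it is 0 otherwise.\<close>

definition prob_part :: "'a measure \<Rightarrow> ('a \<Rightarrow> real) set \<Rightarrow> ('a \<Rightarrow> real) set" where
  "prob_part M F = {p \<in> F. (\<integral>x. p x \<partial>M) = 1}"

definition mix :: "real \<Rightarrow> ('a \<Rightarrow> real) \<Rightarrow> ('a \<Rightarrow> real) \<Rightarrow> 'a \<Rightarrow> real" where
  "mix t f g = (\<lambda>x. (1 - t) * f x + t * g x)"

definition mix_convex :: "('a \<Rightarrow> real) set \<Rightarrow> bool" where
  "mix_convex F \<longleftrightarrow> (\<forall>f\<in>F. \<forall>g\<in>F. \<forall>t\<in>{0..1}. mix t f g \<in> F)"

definition holder_function :: "real \<Rightarrow> (real \<Rightarrow> real) \<Rightarrow> bool" where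
  "holder_function \<gamma> \<phi> \<longleftrightarrow> (\<forall>z\<ge>0. \<phi> z \<ge> - (z powr (1 + \<gamma>))) \<and> \<phi> 1 = -1"

definition holder_score ::
  "'a measure \<Rightarrow> real \<Rightarrow> (real \<Rightarrow> real) \<Rightarrow> ('a \<Rightarrow> real) \<Rightarrow> ('a \<Rightarrow> real) \<Rightarrow> real" where
  "holder_score M \<gamma> \<phi> f g =
     \<phi> ((\<integral>x. f x * g x powr \<gamma> \<partial>M) / (\<integral>x. g x powr (1 + \<gamma>) \<partial>M)) * (\<integral>x. g x powr (1 + \<gamma>) \<partial>M)"

text \<open>\<open>Gs g\<close> is the chosen subgradient of the potential \<open>G\<close> at \<open>g\<close>.\<close>

definition bregman_potential ::
  "'a measure \<Rightarrow> ('a \<Rightarrow> real) set \<Rightarrow> (('a \<Rightarrow> real) \<Rightarrow> real) \<Rightarrow> (('a \<Rightarrow> real) \<Rightarrow> 'a \<Rightarrow> real) \<Rightarrow> bool" where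
  "bregman_potential M F G Gs \<longleftrightarrow>
     F \<subseteq> L0_plus M \<and> mix_convex F \<and>
     (\<forall>f\<in>F. \<forall>g\<in>F. \<forall>t\<in>{0..1}. G (mix t f g) \<le> (1 - t) * G f + t * G g) \<and>
     (\<forall>p\<in>prob_part M F. \<forall>q\<in>prob_part M F. \<forall>t\<in>{0<..<1}.
        \<not> (AE x in M. p x = q x) \<longrightarrow> G (mix t p q) < (1 - t) * G p + t * G q) \<and>
     (\<forall>f\<in>F. \<forall>g\<in>F. integrable M (\<lambda>x. Gs g x * f x) \<and>
        G f \<ge> G g + (\<integral>x. Gs g x * f x \<partial>M) - (\<integral>x. Gs g x * g x \<partial>M))"

definition bregman_score ::
  "'a measure \<Rightarrow> (('a \<Rightarrow> real) \<Rightarrow> real) \<Rightarrow> (('a \<Rightarrow> real) \<Rightarrow> 'a \<Rightarrow> real)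
    \<Rightarrow> ('a \<Rightarrow> real) \<Rightarrow> ('a \<Rightarrow> real) \<Rightarrow> real" where
  "bregman_score M G Gs f g = - G g - (\<integral>x. Gs g x * f x \<partial>M) + (\<integral>x. Gs g x * g x \<partial>M)"

definition strictly_convex_nonneg :: "(real \<Rightarrow> real) \<Rightarrow> bool" where
  "strictly_convex_nonneg J \<longleftrightarrow>
     (\<forall>x\<ge>0. \<forall>y\<ge>0. \<forall>t\<in>{0<..<1}. x \<noteq> y \<longrightarrow> J ((1 - t) * x + t * y) < (1 - t) * J x + t * J y)"

definition separable_potential ::
  "'a measure \<Rightarrow> ('a \<Rightarrow> real) set \<Rightarrow> (('a \<Rightarrow> real) \<Rightarrow> real) \<Rightarrow> bool" where
  "separable_potential M F G \<longleftrightarrow>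
     (\<exists>J. strictly_convex_nonneg J \<and>
        (\<forall>f\<in>F. integrable M (\<lambda>x. J (f x)) \<and> G f = (\<integral>x. J (f x) \<partial>M)))"

definition differentiable_potential :: "('a \<Rightarrow> real) set \<Rightarrow> (('a \<Rightarrow> real) \<Rightarrow> real) \<Rightarrow> bool" where
  "differentiable_potential F G \<longleftrightarrow>
     (\<forall>f\<in>F. \<forall>g\<in>F. (\<exists>\<delta>>0. \<forall>\<epsilon>\<in>{-\<delta><..<\<delta>}. mix \<epsilon> f g \<in> F) \<longrightarrow>
        (\<exists>L. ((\<lambda>\<epsilon>. (G (mix \<epsilon> f g) - G f) / \<epsilon>) \<longlongrightarrow> L) (at 0)))"

definition increasing_transform ::
  "('a \<Rightarrow> real) set \<Rightarrow> (('a \<Rightarrow> real) \<Rightarrow> ('a \<Rightarrow> real) \<Rightarrow> real)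
    \<Rightarrow> (('a \<Rightarrow> real) \<Rightarrow> ('a \<Rightarrow> real) \<Rightarrow> real) \<Rightarrow> bool" where
  "increasing_transform F S S' \<longleftrightarrow>
     (\<exists>\<xi>::real \<Rightarrow> real. strict_mono \<xi> \<and> (\<forall>f\<in>F. \<forall>g\<in>F. S' f g = \<xi> (S f g)))"

text \<open>
  The existence of a strictly increasing \<open>\<xi>\<close> on the whole real line is not obviously symmetric in
  the two scores (an inverse need not extend from its range), so equivalence admits
  either direction.
\<close>

definition equivalent_scores ::
  "('a \<Rightarrow> real) set \<Rightarrow> (('a \<Rightarrow> real) \<Rightarrow> ('a \<Rightarrow> real) \<Rightarrow> real)
    \<Rightarrow> (('a \<Rightarrow> real) \<Rightarrow> ('a \<Rightarrow> real) \<Rightarrow> real) \<Rightarrow> bool" where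
  "equivalent_scores F S S' \<longleftrightarrow> increasing_transform F S S' \<or> increasing_transform F S' S"

text \<open>
  A nonzero measure for which every measurable set is null or conull. Under
  \<open>\<sigma>\<close>-finiteness every measurable function is then almost everywhere constant, say of
  value \<open>z\<close>, and separability carries no information: \<open>z powr \<kappa>\<close> is a separable
  potential for every \<open>\<kappa> > 1\<close>.
\<close>

definition single_atom :: "'a measure \<Rightarrow> bool" where
  "single_atom M \<longleftrightarrow> emeasure M (space M) \<noteq> 0 \<and>
     (\<forall>A\<in>sets M. emeasure M A = 0 \<or> emeasure M (space M - A) = 0)"

lemma mix_convex_Lp_plus:
  assumes "0 \<le> p"
  shows "mix_convex (Lp_plus M p)"
  unfolding mix_convex_def
proof (intro ballI)
  fix f g and t :: real
  assume f: "f \<in> Lp_plus M p" and g: "g \<in> Lp_plus M p" and t: "t \<in> {0..1}"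
  have mf [measurable]: "f \<in> borel_measurable M" and mg [measurable]: "g \<in> borel_measurable M"
    and pf: "\<And>x. x \<in> space M \<Longrightarrow> 0 \<le> f x" and pg: "\<And>x. x \<in> space M \<Longrightarrow> 0 \<le> g x"
    and nf: "\<not> (AE x in M. f x = 0)" and ng: "\<not> (AE x in M. g x = 0)"
    and "integrable M (\<lambda>x. f x powr p)" "integrable M (\<lambda>x. g x powr p)"
    using f g by (auto simp: Lp_plus_def L0_plus_def)
  then have int: "integrable M (\<lambda>x. f x powr p + g x powr p)" by auto
  have le: "mix t f g x powr p \<le> f x powr p + g x powr p" if x: "x \<in> space M" for x
  proof -
    have "mix t f g x \<le> max (f x) (g x)"
      unfolding mix_def using t convex_bound_le[of "f x" "max (f x) (g x)" "g x" "1 - t" t] by auto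
    moreover have "0 \<le> mix t f g x"
      unfolding mix_def using t pf[OF x] pg[OF x] by auto
    ultimately have "mix t f g x powr p \<le> max (f x) (g x) powr p"
      using assms by (intro powr_mono2) auto
    also have "\<dots> \<le> f x powr p + g x powr p" by (auto simp: max_def)
    finally show ?thesis .
  qed
  have "integrable M (\<lambda>x. mix t f g x powr p)"
    by (rule Bochner_Integration.integrable_bound[OF int])
       (use le in \<open>auto simp: mix_def\<close>)
  moreover have "\<not> (AE x in M. mix t f g x = 0)"
  proof
    assume A: "AE x in M. mix t f g x = 0"
    have *: "(1 - t) * f x = 0 \<and> t * g x = 0" if "x \<in> space M" "mix t f g x = 0" for x
      using that t pf pg unfolding mix_def by (auto simp: add_nonneg_eq_0_iff)
    have "AE x in M. (1 - t) * f x = 0"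
      using A by (rule AE_mp) (intro AE_I2 impI conjunct1[OF *])
    moreover have "AE x in M. t * g x = 0"
      using A by (rule AE_mp) (intro AE_I2 impI conjunct2[OF *])
    ultimately show False using nf ng by (cases "t = 0") auto
  qed
  ultimately show "mix t f g \<in> Lp_plus M p"
    using t pf pg unfolding Lp_plus_def L0_plus_def by (auto simp: mix_def)
qed

text \<open>Adding a constant to a potential shifts its score by a constant, and so stays within
  the equivalence class; potentials are determined by it at best up to additive constants.\<close>

lemma bregman_potential_add_const:
  "bregman_potential M F G Gs \<Longrightarrow> bregman_potential M F (\<lambda>f. G f + d) Gs"
  unfolding bregman_potential_def by (auto simp: algebra_simps)

lemma differentiable_potential_add_const:
  "differentiable_potential F G \<Longrightarrow> differentiable_potential F (\<lambda>f. G f + d)"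
  unfolding differentiable_potential_def by auto

lemma equivalent_scores_add_const:
  assumes "equivalent_scores F (bregman_score M G Gs) S"
  shows "equivalent_scores F (bregman_score M (\<lambda>f. G f + d) Gs) S"
proof -
  have *: "bregman_score M (\<lambda>f. G f + d) Gs f g = bregman_score M G Gs f g - d" for f g
    by (simp add: bregman_score_def)
  from assms consider "increasing_transform F (bregman_score M G Gs) S"
    | "increasing_transform F S (bregman_score M G Gs)"
    unfolding equivalent_scores_def by blast
  then show ?thesis
  proof cases
    case 1
    then obtain \<xi> :: "real \<Rightarrow> real" where "strict_mono \<xi>"
      "\<forall>f\<in>F. \<forall>g\<in>F. S f g = \<xi> (bregman_score M G Gs f g)"
      unfolding increasing_transform_def by blast
    then have "increasing_transform F (bregman_score M (\<lambda>f. G f + d) Gs) S"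
      unfolding increasing_transform_def *
      by (intro exI[of _ "\<lambda>x. \<xi> (x + d)"]) (auto simp: strict_mono_def)
    then show ?thesis by (simp add: equivalent_scores_def)
  next
    case 2
    then obtain \<xi> :: "real \<Rightarrow> real" where "strict_mono \<xi>"
      "\<forall>f\<in>F. \<forall>g\<in>F. bregman_score M G Gs f g = \<xi> (S f g)"
      unfolding increasing_transform_def by blast
    then have "increasing_transform F S (bregman_score M (\<lambda>f. G f + d) Gs)"
      unfolding increasing_transform_def *
      by (intro exI[of _ "\<lambda>x. \<xi> x - d"]) (auto simp: strict_mono_def)
    then show ?thesis by (simp add: equivalent_scores_def)
  qed
qed

end

theory Submission
  imports Defs
begin

text \<open>
  Write \<open>p = 1 + \<gamma>\<close> and \<open>N f = \<integral> f\<^sup>p\<close>. Everything in the first claim is decided on one ray. Both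
  scores order pairs \<open>(f, g)\<close> in the same way. On the diagonal they are \<open>- G f\<close> and \<open>- N f\<close>, so
  \<open>G\<close> is a strictly increasing function of \<open>N\<close>. Fix \<open>u\<close> with \<open>N u = 1\<close> and put
  \<open>k b = G (b u)\<close>, so that \<open>G f\<close> is the value of \<open>k\<close> at the \<open>L\<^sup>p\<close> norm of \<open>f\<close>. On the pair
  \<open>(a u, b u)\<close> the Hoelder score is \<open>\<phi> (a / b) b\<^sup>p\<close>. The Bregman score is \<open>- T a b\<close>, where
  \<open>T a b = k b + k' b (a - b)\<close> is the tangent of \<open>k\<close> at \<open>b\<close>: differentiability identifies the
  pairing of the subgradient at \<open>b u\<close> with \<open>u\<close> as \<open>k' b\<close>.

  The Hoelder score is homogeneous in \<open>(a, b)\<close>, hence it has one scale-invariant level, namely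
  zero, and the tangents must respect it (\<open>homogeneous_tangent_order_imp_power\<close>). If \<open>\<phi> z = 0\<close> for
  some \<open>z\<close> strictly between 0 and 1, then \<open>T (z b) b\<close> does not depend on \<open>b\<close>. If there is no such
  \<open>z\<close>, then every \<open>T a b\<close> with \<open>a < b\<close> is a value of \<open>k\<close>, so it lies above the intercept \<open>T 0 b'\<close>
  of every tangent; letting \<open>a\<close> tend to 0 shows that all intercepts agree, which is the same
  conclusion with \<open>z = 0\<close>. In both cases \<open>k - C = (1 - z) b k'\<close> for a constant \<open>C\<close>. This is
  Euler's equation for homogeneous functions of degree \<open>\<kappa> = 1 / (1 - z) \<ge> 1\<close>, and therefore
  \<open>k b = c b\<^sup>\<kappa> + C\<close>.

  For the second claim, a nonzero measure that is not a single atom has two disjoint sets \<open>A\<close>, \<open>B\<close> of finite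
  positive measure. On functions constant on \<open>A\<close> and on \<open>B\<close>, and zero elsewhere, separability
  writes \<open>(s + t)\<^sup>q\<close> with \<open>q = \<kappa> / p\<close> as a function of \<open>s\<close> plus a function of \<open>t\<close>, which forces
  \<open>q = 1\<close> (\<open>additively_separated_power_exponent\<close>). If the total measure is infinite, integrability
  of \<open>J \<circ> f\<close> forces \<open>J 0 = 0\<close>, so \<open>G\<close> is additive over \<open>A\<close> and \<open>B\<close> and the additive constant
  vanishes.
\<close>

section \<open>The Euler equation on a ray\<close>

text \<open>The quotient of \<open>k - C\<close> by \<open>b\<^sup>\<kappa>\<close> has derivative 0 exactly when Euler's equation holds.\<close>

lemma Euler_equation_power_solution:
  fixes k D :: "real \<Rightarrow> real"
  assumes deriv: "\<And>b. 0 < b \<Longrightarrow> (k has_real_derivative D b) (at b)"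
    and euler: "\<And>b. 0 < b \<Longrightarrow> b * D b = \<kappa> * (k b - C)"
  obtains c where "\<And>b. 0 < b \<Longrightarrow> k b = c * b powr \<kappa> + C"
proof -
  have "((\<lambda>b. (k b - C) * b powr (-\<kappa>)) has_real_derivative 0) (at b within {0<..})"
    if "b \<in> {0<..}" for b
  proof -
    have b: "0 < b" using that by simp
    have "((\<lambda>b. (k b - C) * b powr (-\<kappa>)) has_real_derivative
        (k b - C) * (-\<kappa> * b powr (-\<kappa> - 1)) + D b * b powr (-\<kappa>)) (at b)"
      using b deriv[OF b] by (auto intro!: derivative_eq_intros)
    moreover have "(k b - C) * (-\<kappa> * b powr (-\<kappa> - 1)) + D b * b powr (-\<kappa>)
        = (b * D b - \<kappa> * (k b - C)) * b powr (-\<kappa> - 1)"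
      using b powr_add[of b "-\<kappa> - 1" 1] by (simp add: algebra_simps)
    ultimately have "((\<lambda>b. (k b - C) * b powr (-\<kappa>)) has_real_derivative 0) (at b)"
      using euler[OF b] by simp
    then show ?thesis by (rule has_field_derivative_at_within)
  qed
  then obtain c where c: "\<And>b. b \<in> {0<..} \<Longrightarrow> (k b - C) * b powr (-\<kappa>) = c"
    using has_field_derivative_zero_constant[of "{0::real<..}" "\<lambda>b. (k b - C) * b powr (-\<kappa>)"]
    by auto
  show thesis
  proof
    fix b :: real assume b: "0 < b"
    then have "(k b - C) / b powr \<kappa> = c" using c[of b] by (simp add: powr_minus_divide)
    then show "k b = c * b powr \<kappa> + C" using b by (auto simp: field_simps)
  qed
qed

text \<open>
  \<open>D b\<close> is the slope of the supporting line of \<open>k\<close> at \<open>b\<close>, and \<open>level\<close> says that pairs \<open>(a, b)\<close> on a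
  common level of the homogeneous score are on a common level of the tangent value. The goal is
  a ratio \<open>z < 1\<close> for which the tangent at \<open>b\<close>, evaluated at \<open>z b\<close>, is the same for all \<open>b\<close>:
  a zero of \<open>\<phi>\<close>, or \<open>z = 0\<close> when \<open>\<phi>\<close> has no zero between 0 and 1.
\<close>

lemma homogeneous_tangent_order_imp_power:
  fixes k D \<phi> :: "real \<Rightarrow> real" and p :: real
  assumes p: "0 < p" and cont: "continuous_on {0..} \<phi>" and \<phi>1: "\<phi> 1 = -1"
    and deriv: "\<And>b. 0 < b \<Longrightarrow> (k has_real_derivative D b) (at b)"
    and tangent: "\<And>a b. 0 < a \<Longrightarrow> 0 < b \<Longrightarrow> k b + D b * (a - b) \<le> k a"
    and incr: "\<And>a b. 0 < a \<Longrightarrow> a < b \<Longrightarrow> k a < k b"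
    and level: "\<And>a b a' b'. 0 < a \<Longrightarrow> 0 < b \<Longrightarrow> 0 < a' \<Longrightarrow> 0 < b' \<Longrightarrow>
        \<phi> (a / b) * b powr p = \<phi> (a' / b') * b' powr p \<Longrightarrow>
        k b + D b * (a - b) = k b' + D b' * (a' - b')"
  shows "\<exists>c>0. \<exists>d. \<exists>\<kappa>\<ge>1. \<forall>b>0. k b = c * b powr \<kappa> + d"
proof -
  have D_pos: "0 < D b" if "0 < b" for b
  proof -
    have "D b * (b / 2 - b) < 0"
      using tangent[of "b/2" b] incr[of "b/2" b] that by simp
    then show ?thesis using that by (simp add: zero_less_mult_iff)
  qed
  have "\<exists>z C. 0 \<le> z \<and> z < 1 \<and> (\<forall>b>0. k b + D b * (z * b - b) = C)"
  proof (cases "\<exists>z. 0 < z \<and> z < 1 \<and> \<phi> z = 0")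
    case True
    then obtain z where z: "0 < z" "z < 1" "\<phi> z = 0" by blast
    have "k b + D b * (z * b - b) = k 1 + D 1 * (z * 1 - 1)" if "0 < b" for b
      using level[of "z * b" b "z * 1" 1] z that by simp
    then show ?thesis using z by (intro exI[of _ z] exI) auto
  next
    case False
    have neg: "\<phi> z < 0" if z: "0 < z" "z < 1" for z
    proof (rule ccontr)
      assume "\<not> \<phi> z < 0"
      then have "\<exists>x. z \<le> x \<and> x \<le> 1 \<and> \<phi> x = 0"
        using IVT2'[of \<phi> 1 0 z] z \<phi>1 continuous_on_subset[OF cont, of "{z..1}"] by auto
      then obtain x where "z \<le> x" "x \<le> 1" "\<phi> x = 0" by blast
      then show False using False \<phi>1 z by (cases "x = 1") auto
    qed
    have intercept_le: "k b' - D b' * b' \<le> k b - D b * b" if b: "0 < b" "0 < b'" for b b'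
    proof -
      have *: "k b' - D b' * b' \<le> k b + D b * (a - b)" if a: "0 < a" "a < b" for a
      proof -
        (* chosen so that the diagonal pair (c, c), where the tangent value is k c, has the score of (a, b) *)
        define c where "c = (- \<phi> (a / b)) powr (1 / p) * b"
        have n: "\<phi> (a / b) < 0" using neg[of "a / b"] a by simp
        then have c: "0 < c" "c powr p = - \<phi> (a / b) * b powr p"
          using b p unfolding c_def by (auto simp: powr_mult powr_powr)
        then have "k b + D b * (a - b) = k c"
          using level[of a b c c] a b \<phi>1 by simp
        moreover have "k b' + D b' * (c - b') \<le> k c" using tangent[of c b'] c b by simp
        moreover have "0 \<le> D b' * c" using D_pos[of b'] b c by simp
        ultimately show ?thesis by (simp add: algebra_simps)
      qed
      show ?thesis
      proof (rule tendsto_lowerbound)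
        show "((\<lambda>a. k b + D b * (a - b)) \<longlongrightarrow> k b - D b * b) (at_right 0)"
          by (auto intro!: tendsto_eq_intros)
        show "\<forall>\<^sub>F a in at_right 0. k b' - D b' * b' \<le> k b + D b * (a - b)"
          using * b by (auto simp: eventually_at_right)
      qed auto
    qed
    have "k b + D b * (0 * b - b) = k 1 - D 1 * 1" if "0 < b" for b
      using intercept_le[of b 1] intercept_le[of 1 b] that by simp
    then show ?thesis by (intro exI[of _ 0] exI) auto
  qed
  then obtain z C where z: "0 \<le> z" "z < 1"
    and C: "\<And>b. 0 < b \<Longrightarrow> k b + D b * (z * b - b) = C" by blast
  define \<kappa> where "\<kappa> = 1 / (1 - z)"
  have \<kappa>: "1 \<le> \<kappa>" using z by (simp add: \<kappa>_def field_simps)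
  have "b * D b = \<kappa> * (k b - C)" if "0 < b" for b
    using C[OF that] z by (simp add: \<kappa>_def field_simps)
  then obtain c where c: "\<And>b. 0 < b \<Longrightarrow> k b = c * b powr \<kappa> + C"
    using Euler_equation_power_solution[OF deriv] by blast
  have "0 < c * (2 powr \<kappa> - 1)" using incr[of 1 2] c[of 1] c[of 2] by (simp add: algebra_simps)
  moreover have "1 < (2::real) powr \<kappa>" using \<kappa> by simp
  ultimately have "0 < c" by (simp add: zero_less_mult_iff)
  then show ?thesis using c \<kappa> by blast
qed

section \<open>Potentials of Bregman scores equivalent to a Hoelder score\<close>

lemma Lp_plusD:
  assumes "f \<in> Lp_plus M p"
  shows "f \<in> borel_measurable M" "\<And>x. x \<in> space M \<Longrightarrow> 0 \<le> f x"
    "\<not> (AE x in M. f x = 0)" "integrable M (\<lambda>x. f x powr p)"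
  using assms by (auto simp: Lp_plus_def L0_plus_def)

lemma Lp_plus_integral_powr_pos:
  assumes f: "f \<in> Lp_plus M p"
  shows "0 < (\<integral>x. f x powr p \<partial>M)"
proof -
  have "(\<integral>x. f x powr p \<partial>M) \<noteq> 0"
    using integral_nonneg_eq_0_iff_AE[OF Lp_plusD(4)[OF f]] Lp_plusD(3)[OF f] by simp
  moreover have "0 \<le> (\<integral>x. f x powr p \<partial>M)" by simp
  ultimately show ?thesis by linarith
qed

lemma integral_powr_scale:
  assumes f: "f \<in> Lp_plus M p" and "0 < t"
  shows "(\<integral>x. (t * f x) powr p \<partial>M) = t powr p * (\<integral>x. f x powr p \<partial>M)"
proof -
  have "(\<integral>x. (t * f x) powr p \<partial>M) = (\<integral>x. t powr p * f x powr p \<partial>M)"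
    using Lp_plusD(2)[OF f] assms(2)
    by (intro Bochner_Integration.integral_cong) (auto simp: powr_mult)
  then show ?thesis by simp
qed

lemma Lp_plus_scale:
  assumes f: "f \<in> Lp_plus M p" and t: "0 < t"
  shows "(\<lambda>x. t * f x) \<in> Lp_plus M p"
proof -
  have [measurable]: "f \<in> borel_measurable M" using Lp_plusD[OF f] by simp
  have "integrable M (\<lambda>x. t powr p * f x powr p)" using Lp_plusD(4)[OF f] by simp
  then have "integrable M (\<lambda>x. (t * f x) powr p)"
    by (rule Bochner_Integration.integrable_cong[THEN iffD1, rotated 2])
       (use Lp_plusD(2)[OF f] t in \<open>auto simp: powr_mult\<close>)
  then show ?thesis using Lp_plusD[OF f] t by (auto simp: Lp_plus_def L0_plus_def)
qed

text \<open>Along a normalized ray both integrals in the score are monomials, which leaves a function of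
  two positive reals that is homogeneous of degree \<open>1 + \<gamma>\<close>.\<close>

lemma holder_score_ray:
  assumes u: "u \<in> Lp_plus M (1 + \<gamma>)" and u1: "(\<integral>x. u x powr (1 + \<gamma>) \<partial>M) = 1"
    and a: "0 < a" and b: "0 < b"
  shows "holder_score M \<gamma> \<phi> (\<lambda>x. a * u x) (\<lambda>x. b * u x) = \<phi> (a / b) * b powr (1 + \<gamma>)"
proof -
  have "(\<integral>x. (a * u x) * (b * u x) powr \<gamma> \<partial>M) = (\<integral>x. a * b powr \<gamma> * u x powr (1 + \<gamma>) \<partial>M)"
    using Lp_plusD(2)[OF u] b
    by (intro Bochner_Integration.integral_cong) (auto simp: powr_mult powr_mult_base)
  also have "\<dots> = a * b powr \<gamma>" using u1 by simp
  finally have "(\<integral>x. (a * u x) * (b * u x) powr \<gamma> \<partial>M) / b powr (1 + \<gamma>) = a / b"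
    using b by (simp add: powr_add)
  then show ?thesis
    unfolding holder_score_def integral_powr_scale[OF u b] u1 by simp
qed

text \<open>Only the common ordering of pairs is used below, so the direction in which the increasing
  function acts is immaterial.\<close>

lemma equivalent_scores_le_iff:
  assumes "equivalent_scores F S S'" "f \<in> F" "g \<in> F" "f' \<in> F" "g' \<in> F"
  shows "S f g \<le> S f' g' \<longleftrightarrow> S' f g \<le> S' f' g'"
  using assms unfolding equivalent_scores_def increasing_transform_def
  by (auto simp: strict_mono_less_eq)

lemma holder_score_diagonal:
  assumes "\<phi> 1 = -1" and f: "f \<in> Lp_plus M (1 + \<gamma>)"
  shows "holder_score M \<gamma> \<phi> f f = - (\<integral>x. f x powr (1 + \<gamma>) \<partial>M)"
proof -
  have "(\<integral>x. f x * f x powr \<gamma> \<partial>M) = (\<integral>x. f x powr (1 + \<gamma>) \<partial>M)"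
    using Lp_plusD(2)[OF f]
    by (intro Bochner_Integration.integral_cong) (auto simp: powr_mult_base)
  then show ?thesis
    using assms Lp_plus_integral_powr_pos[OF f] by (simp add: holder_score_def)
qed

text \<open>
  Restriction to the ray through a normalized \<open>u\<close> turns the Bregman score into tangent values of
  the one-variable function \<open>k\<close>. The result for \<open>k\<close> extends to all \<open>f\<close>, because the diagonal
  scores show that functions with equal \<open>N\<close> have equal \<open>G\<close>.
\<close>

lemma potential_eq_power_of_norm:
  fixes M :: "'a measure"
  assumes \<gamma>: "0 < \<gamma>" and hf: "\<phi> 1 = -1" and cont: "continuous_on {0..} \<phi>"
    and breg: "bregman_potential M (Lp_plus M (1 + \<gamma>)) G Gs"
    and diff: "differentiable_potential (Lp_plus M (1 + \<gamma>)) G"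
    and equ: "equivalent_scores (Lp_plus M (1 + \<gamma>)) (bregman_score M G Gs) (holder_score M \<gamma> \<phi>)"
  shows "\<exists>c>0. \<exists>d. \<exists>\<kappa>\<ge>1. \<forall>f\<in>Lp_plus M (1 + \<gamma>).
    G f = c * (\<integral>x. f x powr (1 + \<gamma>) \<partial>M) powr (\<kappa> / (1 + \<gamma>)) + d"
proof (cases "Lp_plus M (1 + \<gamma>) = {}")
  case True
  then show ?thesis by (auto intro!: exI[of _ 1])
next
  case False
  define p where "p = 1 + \<gamma>"
  define F where "F = Lp_plus M p"
  define N where "N f = (\<integral>x. f x powr p \<partial>M)" for f :: "'a \<Rightarrow> real"
  note folds = p_def[symmetric] F_def[symmetric]
  have p: "0 < p" using \<gamma> by (simp add: p_def)
  have N_pos: "0 < N f" if "f \<in> F" for f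
    using Lp_plus_integral_powr_pos that by (auto simp: F_def N_def)
  have N_scale: "N (\<lambda>x. t * f x) = t powr p * N f" if "f \<in> F" "0 < t" for f t
    using integral_powr_scale that by (auto simp: F_def N_def)
  have G_le_iff: "G f \<le> G g \<longleftrightarrow> N f \<le> N g" if "f \<in> F" "g \<in> F" for f g
    using equivalent_scores_le_iff[OF equ, of g g f f] that holder_score_diagonal[of \<phi> _ M \<gamma>] hf
    by (simp add: folds N_def bregman_score_def)
  obtain f0 where f0: "f0 \<in> F" using False by (auto simp: folds)
  define u where "u = (\<lambda>x. N f0 powr (-1/p) * f0 x)"
  have u: "u \<in> F"
    unfolding u_def F_def using f0 N_pos[OF f0] by (intro Lp_plus_scale) (auto simp: F_def)
  have u1: "N u = 1"
  proof -
    have "N u = (N f0 powr (-1/p)) powr p * N f0"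
      unfolding u_def using N_scale[OF f0, of "N f0 powr (-1/p)"] N_pos[OF f0] by simp
    also have "(N f0 powr (-1/p)) powr p = N f0 powr (-1)" using p by (simp only: powr_powr) simp
    finally show ?thesis using N_pos[OF f0] by (simp add: powr_minus_divide)
  qed
  have ray: "(\<lambda>x. b * u x) \<in> F" if "0 < b" for b
    using Lp_plus_scale u that by (auto simp: F_def)
  define k where "k b = G (\<lambda>x. b * u x)" for b
  define D where "D b = (\<integral>x. Gs (\<lambda>x. b * u x) x * u x \<partial>M)" for b
  have pairing: "(\<integral>x. Gs (\<lambda>x. b * u x) x * (a * u x) \<partial>M) = D b * a" for a b
  proof -
    have "(\<integral>x. Gs (\<lambda>x. b * u x) x * (a * u x) \<partial>M) = (\<integral>x. (Gs (\<lambda>x. b * u x) x * u x) * a \<partial>M)"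
      by (simp add: mult_ac)
    then show ?thesis by (simp add: D_def)
  qed
  have bregman_ray: "bregman_score M G Gs (\<lambda>x. a * u x) (\<lambda>x. b * u x) = - (k b + D b * (a - b))"
    for a b
    unfolding bregman_score_def pairing by (simp add: k_def algebra_simps)
  have tangent: "k b + D b * (a - b) \<le> k a" if "0 < a" "0 < b" for a b
  proof -
    have "\<And>f g. f \<in> F \<Longrightarrow> g \<in> F \<Longrightarrow>
        G f \<ge> G g + (\<integral>x. Gs g x * f x \<partial>M) - (\<integral>x. Gs g x * g x \<partial>M)"
      using breg unfolding bregman_potential_def folds by blast
    from this[OF ray[OF that(1)] ray[OF that(2)]]
    have "G (\<lambda>x. a * u x) \<ge> G (\<lambda>x. b * u x) + (\<integral>x. Gs (\<lambda>x. b * u x) x * (a * u x) \<partial>M)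
        - (\<integral>x. Gs (\<lambda>x. b * u x) x * (b * u x) \<partial>M)" .
    then show ?thesis unfolding pairing by (simp add: k_def algebra_simps)
  qed
  have deriv: "(k has_real_derivative D b) (at b)" if b: "0 < b" for b
  proof -
    (* moving from b u towards (b + 1) u by \<epsilon> turns the directional derivative into that of k at b *)
    have mix: "mix \<epsilon> (\<lambda>x. b * u x) (\<lambda>x. (b + 1) * u x) = (\<lambda>x. (b + \<epsilon>) * u x)" for \<epsilon>
      by (auto simp: mix_def algebra_simps)
    have "\<exists>\<delta>>0. \<forall>\<epsilon>\<in>{-\<delta><..<\<delta>}. mix \<epsilon> (\<lambda>x. b * u x) (\<lambda>x. (b + 1) * u x) \<in> F"
      unfolding mix using b by (intro exI[of _ b]) (auto intro!: ray)
    then obtain L where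
      "((\<lambda>\<epsilon>. (G (mix \<epsilon> (\<lambda>x. b * u x) (\<lambda>x. (b + 1) * u x)) - G (\<lambda>x. b * u x)) / \<epsilon>) \<longlongrightarrow> L) (at 0)"
      using diff ray[of b] ray[of "b + 1"] b unfolding differentiable_potential_def folds by force
    then have L: "(k has_real_derivative L) (at b)"
      unfolding mix by (simp add: DERIV_def k_def)
    (* k minus its supporting line is minimal at b, so the slope of that line is the derivative *)
    have "((\<lambda>a. k a - (k b + D b * (a - b))) has_real_derivative L - D b) (at b)"
      using L by (auto intro!: derivative_eq_intros)
    then have "L - D b = 0"
    proof (rule DERIV_local_min[OF _ b], intro allI impI)
      fix a assume "\<bar>b - a\<bar> < b"
      then have "0 < a" by linarith
      then show "k b - (k b + D b * (b - b)) \<le> k a - (k b + D b * (a - b))"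
        using tangent[of a b] b by simp
    qed
    then show ?thesis using L by simp
  qed
  have "\<exists>c>0. \<exists>d. \<exists>\<kappa>\<ge>1. \<forall>b>0. k b = c * b powr \<kappa> + d"
  proof (rule homogeneous_tangent_order_imp_power[OF p cont hf deriv tangent])
    fix a b :: real assume ab: "0 < a" "a < b"
    then have "a powr p < b powr p" using p by (intro powr_less_mono2) auto
    then show "k a < k b"
      using G_le_iff[of "\<lambda>x. b * u x" "\<lambda>x. a * u x"] ray[of a] ray[of b] ab N_scale[OF u] u1
      by (simp add: k_def not_le[symmetric])
  next
    fix a b a' b' :: real
    assume pos: "0 < a" "0 < b" "0 < a'" "0 < b'"
      and eq: "\<phi> (a / b) * b powr p = \<phi> (a' / b') * b' powr p"
    have "holder_score M \<gamma> \<phi> (\<lambda>x. a * u x) (\<lambda>x. b * u x)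
        = holder_score M \<gamma> \<phi> (\<lambda>x. a' * u x) (\<lambda>x. b' * u x)"
      using holder_score_ray[of u M \<gamma>] u u1 pos eq by (simp add: folds N_def)
    then have "bregman_score M G Gs (\<lambda>x. a * u x) (\<lambda>x. b * u x)
        = bregman_score M G Gs (\<lambda>x. a' * u x) (\<lambda>x. b' * u x)"
      using equivalent_scores_le_iff[OF equ, unfolded folds,
              OF ray[OF pos(1)] ray[OF pos(2)] ray[OF pos(3)] ray[OF pos(4)]]
        equivalent_scores_le_iff[OF equ, unfolded folds,
              OF ray[OF pos(3)] ray[OF pos(4)] ray[OF pos(1)] ray[OF pos(2)]]
      by (intro antisym) auto
    then show "k b + D b * (a - b) = k b' + D b' * (a' - b')" unfolding bregman_ray by simp
  qed
  then obtain c d \<kappa> where c: "0 < c" "1 \<le> \<kappa>" and k: "\<And>b. 0 < b \<Longrightarrow> k b = c * b powr \<kappa> + d"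
    by blast
  have "G f = c * N f powr (\<kappa> / p) + d" if f: "f \<in> F" for f
  proof -
    define t where "t = N f powr (1 / p)"
    have t: "0 < t" using N_pos[OF f] by (simp add: t_def)
    have "N (\<lambda>x. t * u x) = N f"
      using N_scale[OF u t] u1 N_pos[OF f] p by (simp add: t_def powr_powr)
    then have "G f = k t"
      using G_le_iff[OF f ray[OF t]] G_le_iff[OF ray[OF t] f] by (simp add: k_def)
    then show ?thesis using k[OF t] by (simp add: t_def powr_powr)
  qed
  then show ?thesis using c unfolding folds N_def by blast
qed

section \<open>Separable potentials\<close>

text \<open>Under separation the increment from \<open>s + 1\<close> to \<open>s + 2\<close> of the power function does not depend
  on \<open>s\<close>. Differentiating in \<open>s\<close> equates the derivatives of the power function at two distinct points.\<close>

lemma additively_separated_power_exponent: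
  fixes U V :: "real \<Rightarrow> real"
  assumes "c \<noteq> 0" "q \<noteq> 0"
    and sep: "\<And>s t. 0 < s \<Longrightarrow> 0 < t \<Longrightarrow> U s + V t = c * (s + t) powr q + d"
  shows "q = 1"
proof -
  have "\<forall>\<^sub>F s in nhds (1::real). 0 < s"
    using order_tendstoD(1)[OF filterlim_ident, of "0::real" 1] by simp
  then have "\<forall>\<^sub>F s in nhds 1. c * ((s + 2) powr q - (s + 1) powr q) = V 2 - V 1"
  proof eventually_elim
    case (elim s)
    then show ?case using sep[of s 1] sep[of s 2] by (simp add: algebra_simps)
  qed
  then have "((\<lambda>s. c * ((s + 2) powr q - (s + 1) powr q)) has_real_derivative 0) (at 1)"
    by (subst DERIV_cong_ev[OF refl _ refl]) auto
  moreover have "((\<lambda>s. c * ((s + 2) powr q - (s + 1) powr q)) has_real_derivative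
      c * (q * 3 powr (q - 1) - q * 2 powr (q - 1))) (at 1)"
    by (auto intro!: derivative_eq_intros)
  ultimately have "c * (q * 3 powr (q - 1) - q * 2 powr (q - 1)) = 0"
    using DERIV_unique by blast
  then have "(3::real) powr (q - 1) = 2 powr (q - 1)"
    using assms by simp
  then have "(q - 1) * ln 3 = (q - 1) * ln (2::real)" by (metis ln_powr zero_neq_numeral)
  then show ?thesis by simp
qed

lemma (in sigma_finite_measure) obtain_finite_positive_subset:
  assumes A: "A \<in> sets M" and pos: "emeasure M A \<noteq> 0"
  obtains B where "B \<in> sets M" "B \<subseteq> A" "0 < measure M B" "emeasure M B < \<infinity>"
proof -
  obtain E :: "nat \<Rightarrow> 'a set" where E: "range E \<subseteq> sets M" "(\<Union>i. E i) = space M"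
    "\<And>i. emeasure M (E i) \<noteq> \<infinity>" using sigma_finite by blast
  have "\<exists>i. emeasure M (A \<inter> E i) \<noteq> 0"
  proof (rule ccontr)
    assume "\<not> ?thesis"
    then have "(\<Union>i. A \<inter> E i) \<in> null_sets M"
      using A E(1) by (intro null_sets_UN) (auto intro!: null_setsI)
    moreover have "(\<Union>i. A \<inter> E i) = A" using E(2) sets.sets_into_space[OF A] by auto
    ultimately show False using pos by auto
  qed
  then obtain i where i: "emeasure M (A \<inter> E i) \<noteq> 0" by blast
  have Ei: "E i \<in> sets M" using E(1) by auto
  have "emeasure M (A \<inter> E i) \<le> emeasure M (E i)" using Ei by (intro emeasure_mono) auto
  also have "\<dots> < \<infinity>" using E(3)[of i] by (simp add: less_top)
  finally have fin: "emeasure M (A \<inter> E i) < \<infinity>" .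
  have "0 < measure M (A \<inter> E i)"
    using i fin by (auto simp: measure_def enn2real_positive_iff zero_less_iff_neq_zero)
  then show thesis using that[of "A \<inter> E i"] A Ei fin by auto
qed

text \<open>
  The potential is tested on \<open>f x y = x 1\<^sub>A + y 1\<^sub>B\<close>. The substitution \<open>s = measure M A * x powr p\<close>,
  \<open>t = measure M B * y powr p\<close> makes \<open>N\<close> the sum \<open>s + t\<close>. In infinite total measure the remaining set
  \<open>R\<close> has infinite measure and \<open>J \<circ> f\<close> is the constant \<open>J 0\<close> on it.
\<close>

lemma separable_power_potential:
  assumes "sigma_finite_measure M" and p: "0 < p" and c: "0 < c" and q: "0 < q"
    and G: "\<And>f. f \<in> Lp_plus M p \<Longrightarrow> G f = c * (\<integral>x. f x powr p \<partial>M) powr q + d"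
    and sep: "separable_potential M (Lp_plus M p) G"
    and "emeasure M (space M) \<noteq> 0" and atom: "\<not> single_atom M"
  shows "q = 1" and "emeasure M (space M) = \<infinity> \<Longrightarrow> d = 0"
proof -
  interpret sigma_finite_measure M by fact
  obtain A0 where A0: "A0 \<in> sets M" "emeasure M A0 \<noteq> 0" "emeasure M (space M - A0) \<noteq> 0"
    using assms(7) atom by (auto simp: single_atom_def)
  obtain A where A: "A \<in> sets M" "A \<subseteq> A0" "0 < measure M A" "emeasure M A < \<infinity>"
    using obtain_finite_positive_subset[OF A0(1,2)] by blast
  obtain B where B: "B \<in> sets M" "B \<subseteq> space M - A0" "0 < measure M B" "emeasure M B < \<infinity>"
    using obtain_finite_positive_subset[of "space M - A0"] A0 by blast
  have disj: "A \<inter> B = {}" using A(2) B(2) by auto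
  obtain J where J: "\<And>f. f \<in> Lp_plus M p \<Longrightarrow> integrable M (\<lambda>x. J (f x)) \<and> G f = (\<integral>x. J (f x) \<partial>M)"
    using sep by (auto simp: separable_potential_def)
  define R where "R = space M - A - B"
  define \<rho> where "\<rho> = (\<integral>x. J 0 * indicator R x \<partial>M)"
  let ?\<alpha> = "measure M A" and ?\<beta> = "measure M B"
  define f where "f x y = (\<lambda>w. x * indicator A w + y * indicator B w :: real)" for x y
  note [measurable] = A(1) B(1)
  have comp: "h (f x y w) = h x * indicator A w + h y * indicator B w + h 0 * indicator R w"
    if "w \<in> space M" for h :: "real \<Rightarrow> real" and x y w
    using that disj by (auto simp: f_def R_def indicator_def)
  have intA: "integrable M (\<lambda>w. r * indicator A w :: real)"
    and intB: "integrable M (\<lambda>w. r * indicator B w :: real)" for r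
    using A B by auto
  have powr_f: "f x y w powr p = x powr p * indicator A w + y powr p * indicator B w"
    if "w \<in> space M" for x y w
    using comp[OF that, of "\<lambda>r. r powr p" x y] by simp
  have int_powr: "integrable M (\<lambda>w. f x y w powr p)" for x y
  proof -
    have "integrable M (\<lambda>w. x powr p * indicator A w + y powr p * indicator B w)"
      using intA intB by (rule Bochner_Integration.integrable_add)
    then show ?thesis
      by (rule Bochner_Integration.integrable_cong[THEN iffD2, rotated 2]) (auto simp: powr_f)
  qed
  have N_f: "(\<integral>w. f x y w powr p \<partial>M) = ?\<alpha> * x powr p + ?\<beta> * y powr p" for x y
  proof -
    have "(\<integral>w. f x y w powr p \<partial>M) = (\<integral>w. x powr p * indicator A w + y powr p * indicator B w \<partial>M)"
      by (rule Bochner_Integration.integral_cong[OF refl powr_f])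
    also have "\<dots> = ?\<alpha> * x powr p + ?\<beta> * y powr p"
      by (subst Bochner_Integration.integral_add[OF intA intB]) (simp add: A B)
    finally show ?thesis .
  qed
  have f_in: "f x y \<in> Lp_plus M p" if xy: "0 \<le> x" "0 \<le> y" "0 < x \<or> 0 < y" for x y
  proof -
    have "\<not> (AE w in M. f x y w = 0)"
    proof
      assume "AE w in M. f x y w = 0"
      then have "(\<integral>w. f x y w powr p \<partial>M) = 0"
        by (intro integral_eq_zero_AE) auto
      moreover have "0 < ?\<alpha> * x powr p + ?\<beta> * y powr p"
        using xy A(3) B(3) by (cases "x = 0"; cases "y = 0") (auto intro!: add_pos_pos)
      ultimately show False using N_f[of x y] by simp
    qed
    moreover have "f x y \<in> borel_measurable M" unfolding f_def by measurable
    moreover have "0 \<le> f x y w" for w using xy by (simp add: f_def)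
    ultimately show ?thesis
      using int_powr by (simp add: Lp_plus_def L0_plus_def)
  qed
  have intR: "integrable M (\<lambda>w. J 0 * indicator R w :: real)"
  proof -
    have "integrable M (\<lambda>w. J (f 1 1 w) - J 1 * indicator A w - J 1 * indicator B w)"
      using J[OF f_in[of 1 1]] intA intB by (intro Bochner_Integration.integrable_diff) auto
    then show ?thesis
      by (rule Bochner_Integration.integrable_cong[THEN iffD1, rotated 2]) (auto simp: comp)
  qed
  have E: "?\<alpha> * J x + ?\<beta> * J y + \<rho> = c * (?\<alpha> * x powr p + ?\<beta> * y powr p) powr q + d"
    if "0 \<le> x" "0 \<le> y" "0 < x \<or> 0 < y" for x y
  proof -
    have "G (f x y) = (\<integral>w. J x * indicator A w + J y * indicator B w + J 0 * indicator R w \<partial>M)"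
      using J[OF f_in[OF that]] Bochner_Integration.integral_cong[OF refl comp[where h = J and x = x and y = y]] by simp
    also have "\<dots> = (\<integral>w. J x * indicator A w + J y * indicator B w \<partial>M) + \<rho>"
      unfolding \<rho>_def
      by (rule Bochner_Integration.integral_add) (intro Bochner_Integration.integrable_add intA intB intR)+
    also have "\<dots> = ?\<alpha> * J x + ?\<beta> * J y + \<rho>"
      by (subst Bochner_Integration.integral_add[OF intA intB]) (simp add: A B)
    finally show ?thesis using G[OF f_in[OF that]] N_f[of x y] by simp
  qed
  show q1: "q = 1"
  proof (rule additively_separated_power_exponent)
    show "c \<noteq> 0" "q \<noteq> 0" using c q by auto
    fix s t :: real assume st: "0 < s" "0 < t"
    show "?\<alpha> * J ((s / ?\<alpha>) powr (1 / p)) + (?\<beta> * J ((t / ?\<beta>) powr (1 / p)) + \<rho>)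
        = c * (s + t) powr q + d"
      using E[of "(s / ?\<alpha>) powr (1 / p)" "(t / ?\<beta>) powr (1 / p)"] st A(3) B(3) p
      by (simp add: powr_powr)
  qed
  show "d = 0" if inf: "emeasure M (space M) = \<infinity>"
  proof -
    have "J 0 = 0"
    proof (rule ccontr)
      assume "J 0 \<noteq> 0"
      have R: "R \<in> sets M" unfolding R_def by measurable
      have "integrable M (\<lambda>w. indicator R w :: real)"
        using intR \<open>J 0 \<noteq> 0\<close> by simp
      then have "emeasure M R < \<infinity>"
        using R by (simp add: integrable_indicator_iff)
      moreover have "emeasure M (space M) \<le> emeasure M (A \<union> B) + emeasure M R"
      proof -
        have "space M = (A \<union> B) \<union> R"
          using sets.sets_into_space[OF A(1)] sets.sets_into_space[OF B(1)] by (auto simp: R_def)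
        then show ?thesis using emeasure_subadditive[of "A \<union> B" M R] R A(1) B(1) by simp
      qed
      moreover have "emeasure M (A \<union> B) < \<infinity>"
        using emeasure_subadditive[OF A(1) B(1)] A(4) B(4)
        by (metis ennreal_add_less_top infinity_ennreal_def order_le_less_trans)
      ultimately show False using inf by (auto simp: top_unique less_top[symmetric])
    qed
    then have "\<rho> = 0" by (simp add: \<rho>_def)
    (* the values at 1_A and 1_B add up to the value at their sum, so d + d = d *)
    then show ?thesis
      using E[of 1 0] E[of 0 1] E[of 1 1] \<open>J 0 = 0\<close> q1 A(3) B(3) by (simp add: algebra_simps)
  qed
qed

section \<open>The classification\<close>

theorem theorem2:
  fixes M :: "'a measure" and \<gamma> :: real and \<phi> :: "real \<Rightarrow> real"
    and G :: "('a \<Rightarrow> real) \<Rightarrow> real" and Gs :: "('a \<Rightarrow> real) \<Rightarrow> 'a \<Rightarrow> real"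
  assumes "sigma_finite_measure M"
    and "0 < \<gamma>"
    and "holder_function \<gamma> \<phi>"
    and "continuous_on {0..} \<phi>"
    and "bregman_potential M (Lp_plus M (1 + \<gamma>)) G Gs"
    and "differentiable_potential (Lp_plus M (1 + \<gamma>)) G"
    and "equivalent_scores (Lp_plus M (1 + \<gamma>)) (bregman_score M G Gs) (holder_score M \<gamma> \<phi>)"
  shows "(\<exists>c>0. \<exists>d. \<exists>\<kappa>\<ge>1. \<forall>f\<in>Lp_plus M (1 + \<gamma>).
            G f = c * (\<integral>x. f x powr (1 + \<gamma>) \<partial>M) powr (\<kappa> / (1 + \<gamma>)) + d) \<and>
         (separable_potential M (Lp_plus M (1 + \<gamma>)) G \<and> \<not> single_atom M \<longrightarrow>
          (\<exists>c>0. \<exists>d. (emeasure M (space M) = \<infinity> \<longrightarrow> d = 0) \<and>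
            (\<forall>f\<in>Lp_plus M (1 + \<gamma>). G f = c * (\<integral>x. f x powr (1 + \<gamma>) \<partial>M) + d)))"
proof -
  have power: "\<exists>c>0. \<exists>d. \<exists>\<kappa>\<ge>1. \<forall>f\<in>Lp_plus M (1 + \<gamma>).
      G f = c * (\<integral>x. f x powr (1 + \<gamma>) \<partial>M) powr (\<kappa> / (1 + \<gamma>)) + d"
    using potential_eq_power_of_norm[OF assms(2) _ assms(4-7)] assms(3)
    by (simp add: holder_function_def)
  have "\<exists>c>0. \<exists>d. (emeasure M (space M) = \<infinity> \<longrightarrow> d = 0) \<and>
      (\<forall>f\<in>Lp_plus M (1 + \<gamma>). G f = c * (\<integral>x. f x powr (1 + \<gamma>) \<partial>M) + d)"
    if sep: "separable_potential M (Lp_plus M (1 + \<gamma>)) G" and atom: "\<not> single_atom M"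
  proof (cases "emeasure M (space M) = 0")
    case True
    then have "AE x in M. P x" for P
      by (intro AE_I[of _ _ "space M"]) auto
    then have "Lp_plus M (1 + \<gamma>) = {}" by (auto simp: Lp_plus_def L0_plus_def)
    then show ?thesis using True by (auto intro!: exI[of _ 1])
  next
    case False
    obtain c d \<kappa> where c: "0 < c" "1 \<le> \<kappa>"
      and G: "\<And>f. f \<in> Lp_plus M (1 + \<gamma>) \<Longrightarrow>
        G f = c * (\<integral>x. f x powr (1 + \<gamma>) \<partial>M) powr (\<kappa> / (1 + \<gamma>)) + d"
      using power by blast
    have pos: "0 < 1 + \<gamma>" "0 < \<kappa> / (1 + \<gamma>)" using assms(2) c by auto
    note * = separable_power_potential[OF assms(1) pos(1) c(1) pos(2) G sep False atom]
    have "G f = c * (\<integral>x. f x powr (1 + \<gamma>) \<partial>M) + d" if "f \<in> Lp_plus M (1 + \<gamma>)" for f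
      using G[OF that] *(1) Lp_plus_integral_powr_pos[OF that] by simp
    then show ?thesis using c *(2) by blast
  qed
  then show ?thesis using power by blast
qed

end
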